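(* Let $m,n$ be positive integers with $n\ge 1200\sqrt{m}$. Consider the card guessing game with partial feedback with parameters $m,n$. Then for every guessing strategy $\mathcal{G}$, $$\mathbb{E}\left(P(\mathcal{G})\right)\le m+500\sqrt{m}.$$
   Context: The card guessing game with partial feedback with parameters $m,n$: a deck of $mn$ cards, consisting of $m$ copies of each of the labels $1,2,\dots,n$, is shuffled uniformly at random. In rounds $t=1,\dots,mn$ the Guesser guesses a label $g_t\in\{1,\dots,n\}$ for the $t$-th card of the deck, and is then told only whether the guess was correct (i.e. whether the $t$-th card has label $g_t$). A guessing strategy $\mathcal{G}$ specifies each guess $g_t$ as a function (possibly randomized, with randomness independent of the deck) of the previous feedback. $P(\mathcal{G})$ denotes the number of correct guesses made over the $mn$ rounds when using $\mathcal{G}$. *)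

theory Defs
  imports "HOL-Probability.Probability" "HOL-Combinatorics.Multiset_Permutations"
begin

text \<open>A (possibly randomized) guessing strategy in behavioural form: given the history
  of previous rounds (each a pair of the guess made and the feedback bit received),
  it returns a probability distribution over the next guess. Fresh randomness in
  each round, depending on the whole history, covers all randomized strategies.\<close>

type_synonym strategy = "(nat \<times> bool) list \<Rightarrow> nat pmf"

fun play :: "strategy \<Rightarrow> (nat \<times> bool) list \<Rightarrow> nat list \<Rightarrow> nat pmf" where
  "play G h [] = return_pmf 0"
| "play G h (c # cs) =
     bind_pmf (G h) (\<lambda>g.
       map_pmf (\<lambda>k. k + (if g = c then 1 else 0)) (play G (h @ [(g, g = c)]) cs))"

definition deck_mset :: "nat \<Rightarrow> nat \<Rightarrow> nat multiset" where
  "deck_mset m n = (\<Sum>i\<in>{1..n}. replicate_mset m i)"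

definition deck :: "nat \<Rightarrow> nat \<Rightarrow> nat list pmf" where
  "deck m n = pmf_of_set (permutations_of_multiset (deck_mset m n))"

definition score :: "nat \<Rightarrow> nat \<Rightarrow> strategy \<Rightarrow> nat pmf" where
  "score m n G = bind_pmf (deck m n) (\<lambda>d. play G [] d)"

definition valid_strategy :: "nat \<Rightarrow> strategy \<Rightarrow> bool" where
  "valid_strategy n G \<longleftrightarrow> (\<forall>h. set_pmf (G h) \<subseteq> {1..n})"

end

theory Submission
  imports Defs
begin

text \<open>
  Write \<open>N = m n\<close>. After a history with \<open>a\<^sub>i\<close> correct and \<open>b\<^sub>i\<close> incorrect guesses of label \<open>i\<close>,
  a guess of \<open>g\<close> is correct with probability at most \<open>(m - a\<^sub>g) / (N - \<Sum>\<^sub>i a\<^sub>i - b\<^sub>g)\<close>: transposing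
  the current position with any position at which \<open>g\<close> is not excluded shows that the current position is
  the least likely place for \<open>g\<close>. What remains is a control problem, solved by a potential that bounds the
  expected number of future hits. If all denominators were equal to \<open>N - a\<^sub>g - b\<^sub>g\<close>, the hits of
  one label would behave like draws without replacement, and the advantage \<open>x = (a\<^sub>g + b\<^sub>g) / n - a\<^sub>g\<close>
  accumulated on it is controlled by \<open>sqrt (x\<^sup>2 + m) - sqrt m\<close>, whose expected growth plus the expected gain
  over the rate \<open>1 / n\<close> is \<open>O(1 / (n sqrt m))\<close> per round. At most one label is guessed in more
  than half of the rounds; only for that label the denominator becomes small, and it gets a
  potential in terms of the exact denominator. The influence of the hits of the other labels on the
  denominators is of lower order since \<open>n \<ge> 1200 sqrt m\<close>; it is paid by terms that are linear and
  quadratic in the number of hits of these labels. This gives \<open>m + 11 sqrt m\<close>.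
\<close>

section \<open>Square-root potentials for a single label\<close>

lemma sqrt_le_tangent:
  fixes y s :: real
  assumes "y \<ge> 0" "s > 0"
  shows "sqrt y \<le> s + (y - s\<^sup>2) / (2 * s)"
proof -
  have "0 \<le> (sqrt y - s)\<^sup>2" by simp
  also have "\<dots> = y - 2 * s * sqrt y + s\<^sup>2" using assms by (simp add: power2_diff)
  finally show ?thesis using assms by (simp add: field_simps power2_eq_square)
qed

text \<open>The tangent is taken at the old state, so both outcomes of a round get bounds with the
  same denominator and the expectation can be computed.\<close>

lemma sqrt_shift_le:
  fixes x d v v' :: real
  assumes "v > 0" "v' \<ge> 0"
  shows "sqrt ((x + d)\<^sup>2 + v')
    \<le> sqrt (x\<^sup>2 + v) + (2 * x * d + d\<^sup>2 + v' - v) / (2 * sqrt (x\<^sup>2 + v))"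
proof -
  have pos: "x\<^sup>2 + v > 0" using assms by (simp add: add_nonneg_pos)
  have "sqrt ((x + d)\<^sup>2 + v')
    \<le> sqrt (x\<^sup>2 + v) + ((x + d)\<^sup>2 + v' - (sqrt (x\<^sup>2 + v))\<^sup>2) / (2 * sqrt (x\<^sup>2 + v))"
    by (rule sqrt_le_tangent) (use pos assms in auto)
  also have "(x + d)\<^sup>2 + v' - (sqrt (x\<^sup>2 + v))\<^sup>2 = 2 * x * d + d\<^sup>2 + v' - v"
    using pos by (simp add: power2_sum)
  finally show ?thesis .
qed

text \<open>Here \<open>q\<close> is the hit probability, \<open>e\<close> the rate granted per
  round, \<open>c\<close> the denominator of the hit probability and \<open>y\<close> the
  disturbance by other labels. To first order the excess gain is
  \<open>(1 - x / s) * (q - e)\<close>. A large advantage \<open>x\<close> raises \<open>q\<close>,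
  but then \<open>1 - x / s\<close> is small: their product stays below
  \<open>v / (2 * s * c)\<close>, up to the part due to \<open>y\<close>.\<close>

lemma expected_sqrt_shift_le:
  fixes x v v' q e :: real
  assumes v: "v > 0" "v' \<ge> 0" "v' \<le> v" and q: "0 \<le> q" "q \<le> 1" and e: "0 \<le> e" and
    r: "q \<le> e + r" "r * c \<le> x + y" "c > 0" "y \<ge> 0"
  defines "s \<equiv> sqrt (x\<^sup>2 + v)"
  shows "q * (1 + sqrt ((x + (e - 1))\<^sup>2 + v')) + (1 - q) * sqrt ((x + e)\<^sup>2 + v') - e
    \<le> s + v / (2 * s * c) + 2 * y / c + (q + e\<^sup>2) / (2 * s)"
proof -
  have pos: "x\<^sup>2 + v > 0" using v(1) by (simp add: add_nonneg_pos)
  have s: "s > 0" "s\<^sup>2 = x\<^sup>2 + v" using pos by (auto simp: s_def)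
  have xs: "\<bar>x\<bar> \<le> s" unfolding s_def using v by (intro real_le_rsqrt) auto
  have "q * (1 + sqrt ((x + (e - 1))\<^sup>2 + v')) + (1 - q) * sqrt ((x + e)\<^sup>2 + v')
    \<le> q * (1 + (s + (2 * x * (e - 1) + (e - 1)\<^sup>2 + v' - v) / (2 * s)))
      + (1 - q) * (s + (2 * x * e + e\<^sup>2 + v' - v) / (2 * s))"
    unfolding s_def using q v
    by (intro add_mono mult_left_mono sqrt_shift_le order_refl) auto
  \<comment> \<open>The expected displacement of \<open>x\<close> is \<open>e - q\<close>, which
    changes the root by \<open>(x / s) * (e - q)\<close> and so offsets part of the gain
    \<open>q\<close>.\<close>
  also have "\<dots> = s + e + (1 - x / s) * (q - e) + (q * (1 - 2 * e) + e\<^sup>2 - (v - v')) / (2 * s)"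
    using s(1) by (simp add: field_simps power2_eq_square)
  also have "(q * (1 - 2 * e) + e\<^sup>2 - (v - v')) / (2 * s) \<le> (q + e\<^sup>2) / (2 * s)"
    using s v mult_nonneg_nonneg[OF q(1) e]
    by (intro divide_right_mono) (auto simp: algebra_simps)
  also have "(1 - x / s) * (q - e) \<le> (1 - x / s) * ((x + y) / c)"
  proof (rule mult_left_mono)
    have "r \<le> (x + y) / c" using r by (simp add: field_simps)
    then show "q - e \<le> (x + y) / c" using r by linarith
    show "0 \<le> 1 - x / s" using xs s by (simp add: field_simps)
  qed
  also have "(1 - x / s) * ((x + y) / c) = (x * (s - x) / s + (1 - x / s) * y) / c"
    using s r by (simp add: field_simps)
  also have "\<dots> \<le> (v / (2 * s) + 2 * y) / c"
  proof (intro divide_right_mono add_mono mult_right_mono)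
    \<comment> \<open>With \<open>s^2 = x^2 + v\<close> the square expands to
      \<open>2 * x^2 + v - 2 * s * x\<close>.\<close>
    have "0 \<le> (s - x)\<^sup>2" by simp
    then have "x * (s - x) \<le> v / 2" using s(2) by (simp add: power2_eq_square algebra_simps)
    then have "x * (s - x) / s \<le> v / 2 / s" using s by (intro divide_right_mono) auto
    then show "x * (s - x) / s \<le> v / (2 * s)" by simp
    show "1 - x / s \<le> 2" using xs s by (simp add: field_simps)
  qed (use r in auto)
  finally show ?thesis by (simp add: add_divide_distrib)
qed

text \<open>Subtracting \<open>sqrt v\<close> makes a label that was never guessed contribute 0, so
  the sum over all labels starts at 0.\<close>

definition light_pot :: "real \<Rightarrow> real \<Rightarrow> real" where
  "light_pot v x = sqrt (x\<^sup>2 + v) - sqrt v"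

text \<open>
  \<open>L\<close> is the denominator of the hit probability and \<open>R\<close> the number of copies not yet found. The square
  root fails to be a potential for \<open>L < n\<close>, but there the trivial potential \<open>R\<close> is the smaller one.
\<close>

definition heavy_pot :: "real \<Rightarrow> real \<Rightarrow> real \<Rightarrow> real" where
  "heavy_pot n L R = min R (sqrt ((R - L / n)\<^sup>2 + L / n) + 4 * sqrt (L / n))"

lemma light_pot_nonneg: "0 \<le> v \<Longrightarrow> 0 \<le> light_pot v x"
  by (simp add: light_pot_def)

text \<open>A guess of the heavy label lowers \<open>L\<close> by one whether it hits or misses. If
  \<open>R\<close> attains the minimum, hits plus unfound copies stay constant. Otherwise the drift
  of the root is of order \<open>1 / (n * sqrt v)\<close>, which the decrease of
  \<open>4 * sqrt (L / n)\<close> pays for.\<close>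

lemma heavy_pot_step:
  fixes n L R q :: real
  assumes n: "n \<ge> 1" and L: "L \<ge> 1" and q: "0 \<le> q" "q \<le> 1" "q * L \<le> R"
  shows "q * (1 + heavy_pot n (L - 1) (R - 1)) + (1 - q) * heavy_pot n (L - 1) R
    \<le> heavy_pot n L R + 1 / n"
proof -
  define v x where "v = L / n" and "x = R - v"
  define H where "H = sqrt (x\<^sup>2 + v) + 4 * sqrt v"
  have hp: "heavy_pot n L R = min R H" by (simp add: heavy_pot_def H_def x_def v_def)
  have v0: "v > 0" using n L by (simp add: v_def)
  show ?thesis
  proof (cases "R \<le> H")
    case True
    have "q * (1 + heavy_pot n (L - 1) (R - 1)) + (1 - q) * heavy_pot n (L - 1) R
      \<le> q * (1 + (R - 1)) + (1 - q) * R"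
      using q by (intro add_mono mult_left_mono) (auto simp: heavy_pot_def)
    also have "\<dots> = R" by (simp add: algebra_simps)
    finally have "q * (1 + heavy_pot n (L - 1) (R - 1)) + (1 - q) * heavy_pot n (L - 1) R \<le> R" .
    moreover have "0 \<le> 1 / n" using n by simp
    moreover have "heavy_pot n L R = R" using True by (simp add: hp)
    ultimately show ?thesis by linarith
  next
    case False
    \<comment> \<open>For \<open>v <= 1\<close>, \<open>R = x + v\<close> is at most
      \<open>sqrt (x^2 + v) + sqrt v\<close>, so the minimum would be \<open>R\<close>.\<close>
    have v1: "v > 1"
    proof (rule ccontr)
      assume "\<not> v > 1"
      then have "v \<le> sqrt v" using v0 by (intro real_le_rsqrt) (auto simp: power2_eq_square mult_le_one)
      moreover have "x \<le> sqrt (x\<^sup>2 + v)" using v0 by (intro real_le_rsqrt) auto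
      ultimately show False using False v0 by (auto simp: H_def x_def)
    qed
    define v' where "v' = (L - 1) / n"
    have v': "v' = v - 1 / n" "v' \<ge> 0" using n L by (auto simp: v'_def v_def diff_divide_distrib divide_right_mono)
    have qL: "q \<le> 1 / n + x / L"
      using q n L by (simp add: x_def v_def field_simps)
    define s where "s = sqrt (x\<^sup>2 + v)"
    have s: "s \<ge> sqrt v" "s > 0" using v0 by (auto simp: s_def add_nonneg_pos)
    have rv: "sqrt v \<ge> 1" using v1 by simp
    have Lv: "L = n * v" using n by (simp add: v_def)
    have "q * (1 + heavy_pot n (L - 1) (R - 1)) + (1 - q) * heavy_pot n (L - 1) R
      \<le> q * (1 + (sqrt ((x + (1 / n - 1))\<^sup>2 + v') + 4 * sqrt v'))
        + (1 - q) * (sqrt ((x + 1 / n)\<^sup>2 + v') + 4 * sqrt v')"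
    proof (intro add_mono mult_left_mono order_refl)
      have eqs: "x + (1 / n - 1) = R - 1 - (L - 1) / n" "x + 1 / n = R - (L - 1) / n"
        by (auto simp: x_def v_def diff_divide_distrib)
      show "heavy_pot n (L - 1) (R - 1) \<le> sqrt ((x + (1 / n - 1))\<^sup>2 + v') + 4 * sqrt v'"
        "heavy_pot n (L - 1) R \<le> sqrt ((x + 1 / n)\<^sup>2 + v') + 4 * sqrt v'"
        unfolding eqs heavy_pot_def v'_def by (rule min.cobounded2)+
    qed (use q in auto)
    also have "\<dots> = (q * (1 + sqrt ((x + (1 / n - 1))\<^sup>2 + v'))
        + (1 - q) * sqrt ((x + 1 / n)\<^sup>2 + v') - 1 / n) + 1 / n + 4 * sqrt v'"
      by (simp add: algebra_simps)
    also have "\<dots> \<le> (s + v / (2 * s * L) + 2 * 0 / L + (q + (1 / n)\<^sup>2) / (2 * s))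
        + 1 / n + 4 * sqrt v'"
      unfolding s_def using v0 v' q n L qL
      by (intro add_right_mono expected_sqrt_shift_le[where r = "x / L"]) auto
    also have "v / (2 * s * L) \<le> 1 / (2 * n * sqrt v)"
      using s n v0 by (simp add: Lv field_simps)
    also have "(q + (1 / n)\<^sup>2) / (2 * s) \<le> 1 / (n * sqrt v) + 1 / (2 * n * sqrt v)"
    proof -
      have "x \<le> s" unfolding s_def using v0 by (intro real_le_rsqrt) auto
      then have "x / L / (2 * s) \<le> 1 / (2 * L)" using s L by (simp add: field_simps)
      also have "\<dots> = 1 / (2 * n * (sqrt v * sqrt v))" using v0 by (simp add: Lv)
      also have "\<dots> \<le> 1 / (2 * n * sqrt v)"
        using rv n v0 mult_left_mono[OF rv, of "sqrt v"]
        by (intro divide_left_mono mult_left_mono mult_pos_pos; simp)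
      finally have 1: "x / L / (2 * s) \<le> 1 / (2 * n * sqrt v)" .
      have "(1 / n + (1 / n)\<^sup>2) / (2 * s) \<le> (1 / n + 1 / n) / (2 * s)"
        using s n by (intro divide_right_mono add_left_mono) (auto simp: power2_eq_square field_simps)
      also have "\<dots> \<le> 1 / (n * sqrt v)" using s n v0 by (simp add: field_simps)
      finally have 2: "(1 / n + (1 / n)\<^sup>2) / (2 * s) \<le> 1 / (n * sqrt v)" .
      have "(q + (1 / n)\<^sup>2) / (2 * s) \<le> (1 / n + x / L + (1 / n)\<^sup>2) / (2 * s)"
        using s qL by (intro divide_right_mono add_right_mono) auto
      also have "\<dots> = (1 / n + (1 / n)\<^sup>2) / (2 * s) + x / L / (2 * s)"
        by (simp add: add_divide_distrib)
      finally show ?thesis using 1 2 by linarith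
    qed
    \<comment> \<open>This fixes the factor 4: the error terms total
      \<open>1/2 + 1 + 1/2 = 2\<close> units of \<open>1 / (n * sqrt v)\<close>, exactly the
      decrease obtained here.\<close>
    also have "4 * sqrt v' \<le> 4 * sqrt v - 4 / (2 * n * sqrt v)"
    proof -
      have "sqrt v' \<le> sqrt v + (v' - (sqrt v)\<^sup>2) / (2 * sqrt v)"
        by (rule sqrt_le_tangent) (use v0 v' in auto)
      also have "(v' - (sqrt v)\<^sup>2) / (2 * sqrt v) = - (1 / (2 * n * sqrt v))"
        using v0 v' by simp
      finally have "4 * sqrt v' \<le> 4 * (sqrt v + - (1 / (2 * n * sqrt v)))" by (intro mult_left_mono) auto
      also have "\<dots> = 4 * sqrt v - 4 / (2 * n * sqrt v)" by (simp add: ring_distribs)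
      finally show ?thesis .
    qed
    finally have "q * (1 + heavy_pot n (L - 1) (R - 1)) + (1 - q) * heavy_pot n (L - 1) R
      \<le> s + 4 * sqrt v + 1 / n
        + (1 / (2 * n * sqrt v) + (1 / (n * sqrt v) + 1 / (2 * n * sqrt v)) - 4 / (2 * n * sqrt v))"
      by simp
    moreover have "1 / (2 * n * sqrt v) + (1 / (n * sqrt v) + 1 / (2 * n * sqrt v)) - 4 / (2 * n * sqrt v) \<le> 0"
      using n v0 by (simp add: field_simps)
    ultimately show ?thesis using False by (simp add: hp H_def s_def)
  qed
qed

text \<open>Triangle inequality in the plane for the vectors \<open>(x, sqrt v)\<close> and
  \<open>(d, 0)\<close>.\<close>

lemma sqrt_norm_shift:
  fixes x d v v' :: real
  assumes "d \<ge> 0" "v' \<le> v" "v \<ge> 0"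
  shows "sqrt ((x + d)\<^sup>2 + v') \<le> sqrt (x\<^sup>2 + v) + d"
proof -
  have "sqrt ((x + d)\<^sup>2 + v') \<le> sqrt ((x + d)\<^sup>2 + (sqrt v)\<^sup>2)" using assms by simp
  also have "\<dots> = sqrt ((x + d)\<^sup>2 + (sqrt v + 0)\<^sup>2)" by simp
  also have "\<dots> \<le> sqrt (x\<^sup>2 + (sqrt v)\<^sup>2) + sqrt (d\<^sup>2 + 0\<^sup>2)"
    by (rule real_sqrt_sum_squares_triangle_ineq)
  finally show ?thesis using assms by simp
qed

text \<open>Prices a hit of another label: the confirmed position is lost to the heavy label, while
  none of its copies is found.\<close>

lemma heavy_pot_pred_le:
  assumes "n > 0" "L \<ge> 0"
  shows "heavy_pot n (L - 1) R \<le> heavy_pot n L R + 1 / n"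
proof -
  have eq: "R - (L - 1) / n = (R - L / n) + 1 / n" by (simp add: diff_divide_distrib)
  have "sqrt ((R - (L - 1) / n)\<^sup>2 + (L - 1) / n) \<le> sqrt ((R - L / n)\<^sup>2 + L / n) + 1 / n"
    unfolding eq by (rule sqrt_norm_shift) (use assms in \<open>auto simp: divide_right_mono\<close>)
  moreover have "sqrt ((L - 1) / n) \<le> sqrt (L / n)" using assms by (simp add: divide_right_mono)
  moreover have "0 \<le> 1 / n" using assms by simp
  ultimately show ?thesis unfolding heavy_pot_def min_def
    by (smt (verit))
qed

text \<open>For a light label the denominator stays above \<open>m * n / 4\<close>, so a constant
  \<open>v = m\<close> suffices. The factor \<open>9 / 2\<close> is 2 from the drift plus
  \<open>5 / 2\<close> from the second-order term; the last summand is the disturbance by the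
  \<open>y\<close> hits of other labels.\<close>

lemma light_pot_step:
  fixes m n q x y L :: real
  assumes m: "m \<ge> 1" and n: "n \<ge> 1" and q: "0 \<le> q" "q \<le> 1" "q \<le> 4 / n" and
    r: "q \<le> 1 / n + (x + y / n) / L" and L: "L \<ge> m * n / 4" and y: "y \<ge> 0"
  shows "q * (1 + light_pot m (x + (1 / n - 1))) + (1 - q) * light_pot m (x + 1 / n) - 1 / n
    \<le> light_pot m x + 9 / (2 * n * sqrt m) + 8 * y / (n * (m * n))"
proof -
  define s where "s = sqrt (x\<^sup>2 + m)"
  have s: "s \<ge> sqrt m" "s > 0" "sqrt m > 0" using m by (auto simp: s_def add_nonneg_pos)
  have Lp: "L > 0" "m * n > 0" using L m n by (auto intro: less_le_trans[of _ "m * n / 4"])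
  have "q * (1 + light_pot m (x + (1 / n - 1))) + (1 - q) * light_pot m (x + 1 / n) - 1 / n
    = (q * (1 + sqrt ((x + (1 / n - 1))\<^sup>2 + m)) + (1 - q) * sqrt ((x + 1 / n)\<^sup>2 + m) - 1 / n) - sqrt m"
    by (simp add: light_pot_def algebra_simps)
  also have "\<dots> \<le> (s + m / (2 * s * L) + 2 * (y / n) / L + (q + (1 / n)\<^sup>2) / (2 * s)) - sqrt m"
    unfolding s_def using m n q r y Lp
    by (intro diff_right_mono expected_sqrt_shift_le[where r = "(x + y / n) / L"]) auto
  also have "m / (2 * s * L) \<le> m / (2 * sqrt m * (m * n / 4))"
  proof (rule divide_left_mono)
    show "2 * sqrt m * (m * n / 4) \<le> 2 * s * L"
      using s L Lp by (intro mult_mono mult_left_mono; linarith)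
    show "0 < 2 * s * L * (2 * sqrt m * (m * n / 4))" using s(2,3) Lp m n by simp
  qed (use m in simp)
  also have "\<dots> = 2 / (n * sqrt m)" using m n by (simp add: field_simps)
  also have "2 * (y / n) / L \<le> 2 * (y / n) / (m * n / 4)"
    using L y n Lp by (intro divide_left_mono mult_pos_pos; simp)
  also have "\<dots> = 8 * y / (n * (m * n))" using m n by (simp add: field_simps)
  also have "(q + (1 / n)\<^sup>2) / (2 * s) \<le> (4 / n + 1 / n) / (2 * sqrt m)"
    using s q n by (intro frac_le add_mono) (auto simp: power2_eq_square field_simps)
  finally have "q * (1 + light_pot m (x + (1 / n - 1))) + (1 - q) * light_pot m (x + 1 / n) - 1 / n
    \<le> s + 2 / (n * sqrt m) + 8 * y / (n * (m * n)) + (4 / n + 1 / n) / (2 * sqrt m) - sqrt m"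
    by simp
  moreover have "2 / (n * sqrt m) + (4 / n + 1 / n) / (2 * sqrt m) = 9 / (2 * n * sqrt m)"
    using n s by (simp add: field_simps)
  ultimately show ?thesis by (simp add: s_def light_pot_def)
qed

section \<open>The potential of a game state\<close>

lemma heavy_pot_nonneg: "n > 0 \<Longrightarrow> L \<ge> 0 \<Longrightarrow> R \<ge> 0 \<Longrightarrow> heavy_pot n L R \<ge> 0"
  by (simp add: heavy_pot_def)

text \<open>
  Below, \<open>J\<close> is the label guessed in more than half of the rounds, if there is one already, \<open>a\<close> and \<open>b\<close>
  count hits and misses, \<open>T\<close> is the number of rounds left, and \<open>A\<close> counts the hits of the labels other
  than \<open>J\<close>. The term \<open>5 sqrt m + A / n\<close> is the price of the change of potential when \<open>J\<close> appears,
  the linear term in \<open>A\<close> pays for the disturbed denominators, and the quadratic term makes the potential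
  exceed \<open>N\<close> as soon as \<open>A > N / 5\<close>, so that the step inequality is needed for small \<open>A\<close> only.
\<close>

definition heavy_term ::
  "real \<Rightarrow> real \<Rightarrow> nat set \<Rightarrow> (nat \<Rightarrow> real) \<Rightarrow> (nat \<Rightarrow> real) \<Rightarrow> nat option \<Rightarrow> real" where
  "heavy_term m n K a b J = (case J of
      None \<Rightarrow> 5 * sqrt m + sum a K / n
    | Some i \<Rightarrow> heavy_pot n (m * n - sum a K - b i) (m - a i))"

definition pot ::
  "real \<Rightarrow> real \<Rightarrow> nat set \<Rightarrow> real \<Rightarrow> (nat \<Rightarrow> real) \<Rightarrow> (nat \<Rightarrow> real) \<Rightarrow> nat option \<Rightarrow> real" where
  "pot m n K T a b J = (let I = K - set_option J; A = sum a I in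
      T / n + 6 * T / (n * sqrt m) + 25 * A\<^sup>2 / (m * n) + 208 * T * A / (n * (m * n))
      + (\<Sum>i\<in>I. light_pot m ((a i + b i) / n - a i)) + heavy_term m n K a b J)"

text \<open>Guessing the heavy label changes neither \<open>A\<close> nor any light term, so the
  decrease of \<open>T / n\<close> only has to cover the growth of \<open>heavy_pot\<close>.\<close>

lemma pot_heavy_step:
  fixes m n T q :: real and a b :: "nat \<Rightarrow> real"
  assumes m: "m \<ge> 1" and n: "n \<ge> 1" and K: "finite K" "g \<in> K" and T: "T \<ge> 1"
    and a: "\<And>i. a i \<ge> 0" and q: "0 \<le> q" "q \<le> 1"
  defines "L \<equiv> m * n - sum a K - b g"
  assumes L: "L \<ge> 1" "q * L \<le> m - a g"
  shows "q * (1 + pot m n K (T - 1) (a(g := a g + 1)) b (Some g))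
      + (1 - q) * pot m n K (T - 1) a (b(g := b g + 1)) (Some g)
    \<le> pot m n K T a b (Some g)"
proof -
  define A where "A = sum a (K - {g})"
  define S where "S = (\<Sum>i\<in>K - {g}. light_pot m ((a i + b i) / n - a i))"
  define c where "c = 6 * T / (n * sqrt m) + 25 * A\<^sup>2 / (m * n) + 208 * T * A / (n * (m * n)) + S"
  define c' where
    "c' = 6 * (T - 1) / (n * sqrt m) + 25 * A\<^sup>2 / (m * n) + 208 * (T - 1) * A / (n * (m * n)) + S"
  have A: "A \<ge> 0" unfolding A_def by (intro sum_nonneg a)
  have cc: "c' \<le> c"
    unfolding c_def c'_def using A m n
    by (intro add_mono divide_right_mono mult_right_mono mult_left_mono order_refl) auto
  have sumT: "sum (a(g := a g + 1)) K = sum a K + 1"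
    using K by (simp add: sum.remove[of K g])
  have eq: "pot m n K T a b (Some g) = T / n + c + heavy_pot n L (m - a g)"
    by (simp add: pot_def Let_def heavy_term_def c_def A_def S_def L_def)
  have rest: "sum (a(g := a g + 1)) (K - {g}) = A"
    "(\<Sum>i\<in>K - {g}. light_pot m (((a(g := a g + 1)) i + b i) / n - (a(g := a g + 1)) i)) = S"
    "(\<Sum>i\<in>K - {g}. light_pot m ((a i + (b(g := b g + 1)) i) / n - a i)) = S"
    unfolding A_def S_def by (auto intro: sum.cong)
  have eqT: "pot m n K (T - 1) (a(g := a g + 1)) b (Some g)
    = (T - 1) / n + c' + heavy_pot n (L - 1) (m - a g - 1)"
    unfolding pot_def Let_def heavy_term_def sumT option.set option.case rest c'_def L_def
    by (simp add: algebra_simps)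
  have eqF: "pot m n K (T - 1) a (b(g := b g + 1)) (Some g)
    = (T - 1) / n + c' + heavy_pot n (L - 1) (m - a g)"
    unfolding pot_def Let_def heavy_term_def option.set option.case rest A_def[symmetric] c'_def L_def
    by (simp add: algebra_simps)
  define u where "u = (T - 1) / n + c'"
  have "q * (1 + pot m n K (T - 1) (a(g := a g + 1)) b (Some g))
      + (1 - q) * pot m n K (T - 1) a (b(g := b g + 1)) (Some g)
    = u + (q * (1 + heavy_pot n (L - 1) (m - a g - 1))
      + (1 - q) * heavy_pot n (L - 1) (m - a g))"
    unfolding eqT eqF u_def[symmetric] by (simp add: algebra_simps)
  also have "\<dots> \<le> (T - 1) / n + c + (heavy_pot n L (m - a g) + 1 / n)"
    using cc heavy_pot_step[OF n L(1) q L(2)] unfolding u_def by linarith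
  also have "\<dots> = pot m n K T a b (Some g)"
    by (simp add: eq diff_divide_distrib)
  finally show ?thesis .
qed

text \<open>The budget \<open>6 / (n * sqrt m)\<close> of a round is split: \<open>9 / 2\<close>
  units for the light potential, \<open>3 / 2\<close> for all side effects of a hit, collected in
  \<open>D\<close>.\<close>

lemma pot_light_step:
  fixes m n T q :: real and a b :: "nat \<Rightarrow> real"
  assumes m: "m \<ge> 1" and n: "n \<ge> 1200 * sqrt m" and K: "finite K" "g \<in> K"
    and T: "T \<ge> 1" "T \<le> m * n"
    and a: "\<And>i. a i \<ge> 0" and q: "0 \<le> q" "q \<le> 1"
    and J: "Some g \<noteq> J" "\<And>i. J = Some i \<Longrightarrow> i \<in> K \<and> a i \<le> m \<and> 0 \<le> m * n - sum a K - b i"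
    and light: "2 * (a g + b g) \<le> m * n"
    and A5: "sum a (K - set_option J) \<le> m * n / 5"
    and L: "q * (m * n - sum a K - b g) \<le> m - a g"
  shows "q * (1 + pot m n K (T - 1) (a(g := a g + 1)) b J)
      + (1 - q) * pot m n K (T - 1) a (b(g := b g + 1)) J
    \<le> pot m n K T a b J"
proof -
  define I where "I = K - set_option J"
  define A where "A = sum a I"
  define x where "x = (a g + b g) / n - a g"
  define S where "S = (\<Sum>i\<in>I - {g}. light_pot m ((a i + b i) / n - a i))"
  define y where "y = sum a K - a g"
  have n1: "n \<ge> 1200" using n m order_trans[of 1200 "1200 * sqrt m" n] by simp
  have gI: "g \<in> I" "finite I" using J K by (auto simp: I_def)
  have A: "A \<ge> 0" unfolding A_def by (intro sum_nonneg a)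
  have y0: "y \<ge> 0" unfolding y_def using K a by (simp add: sum.remove[of K g] sum_nonneg)
  have sumK: "sum a K \<le> A + m"
  proof (cases J)
    case (Some i)
    then have "sum a K = a i + A" using J(2) K by (simp add: A_def I_def sum.remove[of K i])
    then show ?thesis using J(2)[OF Some] by simp
  qed (use m in \<open>simp add: A_def I_def\<close>)
  have yA: "y \<le> A + m" using sumK a[of g] by (simp add: y_def)
  \<comment> \<open>The shares of \<open>m * n\<close> add up: \<open>1/5\<close> for
    \<open>A\<close>, \<open>1/20\<close> for the hits of \<open>J\<close>, \<open>1/2\<close> for
    guesses of \<open>g\<close>, which leaves \<open>1/4\<close>.\<close>
  have "m * 20 \<le> m * n" using n1 m by (intro mult_left_mono) auto
  then have L4: "m * n - sum a K - b g \<ge> m * n / 4"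
    using sumK A5 light a[of g] by (simp add: A_def I_def)
  have mn: "m * n > 0" using m n1 by simp
  have "q * (m * n / 4) \<le> m"
    using mult_left_mono[OF L4 q(1)] L a[of g] by linarith
  then have q4: "q \<le> 4 / n" using m n1 by (simp add: field_simps)
  have r: "q \<le> 1 / n + (x + y / n) / (m * n - sum a K - b g)"
  proof -
    define z where "z = m * n - sum a K - b g"
    have z: "z > 0" using L4 mn by (simp add: z_def)
    \<comment> \<open>Splits the unfound copies of \<open>g\<close> into the fair share
      \<open>z / n\<close>, the advantage \<open>x\<close> and the effect of the other hits.\<close>
    have "z / n + (x + y / n) = m - a g"
      using n1 by (simp add: z_def x_def y_def field_simps)
    then have "q \<le> (z / n + (x + y / n)) / z" using L z by (simp add: z_def field_simps)
    then show ?thesis using z by (simp add: z_def[symmetric] add_divide_distrib)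
  qed
  have main: "q * (1 + light_pot m (x + (1 / n - 1))) + (1 - q) * light_pot m (x + 1 / n) - 1 / n
    \<le> light_pot m x + 9 / (2 * n * sqrt m) + 8 * y / (n * (m * n))"
    using m n1 q q4 r L4 y0 by (intro light_pot_step) auto
  have sumT: "sum (a(g := a g + 1)) K = sum a K + 1" "sum (a(g := a g + 1)) I = A + 1"
    using K gI by (simp_all add: A_def sum.remove[of _ g])
  have hT: "heavy_term m n K (a(g := a g + 1)) b J \<le> heavy_term m n K a b J + 1 / n"
  proof (cases J)
    case (Some i)
    then have "i \<noteq> g" using J by auto
    moreover have "m * n - (sum a K + 1) - b i = (m * n - sum a K - b i) - 1" by simp
    ultimately show ?thesis
      using heavy_pot_pred_le[of n "m * n - sum a K - b i" "m - a i"] J(2)[OF Some] n1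
      unfolding heavy_term_def Some option.case sumT(1) by (simp add: algebra_simps)
  next
    case None
    show ?thesis unfolding heavy_term_def None option.case sumT(1) by (simp add: add_divide_distrib)
  qed
  have hF: "heavy_term m n K a (b(g := b g + 1)) J = heavy_term m n K a b J"
    using J(1) by (auto simp: heavy_term_def split: option.split)
  have eq: "pot m n K T a b J = T / n + 6 * T / (n * sqrt m) + 25 * A\<^sup>2 / (m * n)
      + 208 * T * A / (n * (m * n)) + (light_pot m x + S) + heavy_term m n K a b J"
    unfolding pot_def Let_def I_def[symmetric] A_def[symmetric] using gI
    by (simp add: sum.remove[of I g] x_def S_def)
  have eqT: "pot m n K (T - 1) (a(g := a g + 1)) b J
    = (T - 1) / n + 6 * (T - 1) / (n * sqrt m) + 25 * (A + 1)\<^sup>2 / (m * n)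
      + 208 * (T - 1) * (A + 1) / (n * (m * n)) + (light_pot m (x + (1 / n - 1)) + S)
      + heavy_term m n K (a(g := a g + 1)) b J"
  proof -
    have eq: "(a g + 1 + b g) / n - (a g + 1) = x + (1 / n - 1)"
      by (simp add: x_def add_divide_distrib)
    have "(\<Sum>i\<in>I. light_pot m (((a(g := a g + 1)) i + b i) / n - (a(g := a g + 1)) i))
      = light_pot m (x + (1 / n - 1)) + S"
      unfolding sum.remove[OF gI(2,1)] S_def fun_upd_same eq by (auto intro: sum.cong)
    then show ?thesis
      unfolding pot_def Let_def I_def[symmetric] sumT by simp
  qed
  have eqF: "pot m n K (T - 1) a (b(g := b g + 1)) J
    = (T - 1) / n + 6 * (T - 1) / (n * sqrt m) + 25 * A\<^sup>2 / (m * n)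
      + 208 * (T - 1) * A / (n * (m * n)) + (light_pot m (x + 1 / n) + S)
      + heavy_term m n K a b J"
  proof -
    have eq: "(a g + (b g + 1)) / n - a g = x + 1 / n"
      by (simp add: x_def add_divide_distrib)
    have "(\<Sum>i\<in>I. light_pot m ((a i + (b(g := b g + 1)) i) / n - a i))
      = light_pot m (x + 1 / n) + S"
      unfolding sum.remove[OF gI(2,1)] S_def fun_upd_same eq by (auto intro: sum.cong)
    then show ?thesis
      unfolding pot_def Let_def I_def[symmetric] A_def[symmetric] hF by simp
  qed
  \<comment> \<open>A hit raises \<open>A^2\<close> by \<open>2 * A + 1\<close>; the product
    \<open>T * A\<close> changes by \<open>q * (T - 1) - A\<close> in expectation;
    \<open>q / n\<close> bounds the expected rise of the heavy term.\<close>
  define D where "D = 8 * y / (n * (m * n)) + q * (25 * (2 * A + 1) / (m * n))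
    + 208 * (q * (T - 1) - A) / (n * (m * n)) + q / n"
  have D: "D \<le> 3 / (2 * n * sqrt m)"
  proof -
    define e where "e = 1 / (n * n)"
    have e: "n * n * e = 1" "e > 0" using n1 by (simp_all add: e_def)
    \<comment> \<open>In units of \<open>w\<close> the terms linear in \<open>A\<close> cancel,
      \<open>8 + 200 - 208 = 0\<close>, which determines the coefficient 208. In units of
      \<open>e\<close> there remain \<open>8 + 100 + 832 + 4 = 944\<close>, and
      \<open>n >= 1200 * sqrt m\<close> makes this affordable.\<close>
    define w where "w = A / (n * (m * n))"
    have "8 * y / (n * (m * n)) \<le> 8 * (A + m) / (n * (m * n))"
      using yA m n1 by (intro divide_right_mono mult_left_mono) auto
    also have "\<dots> = 8 * w + 8 * e" using m n1 by (simp add: w_def e_def field_simps)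
    finally have 1: "8 * y / (n * (m * n)) \<le> 8 * w + 8 * e" .
    have "q * (25 * (2 * A + 1) / (m * n)) \<le> 4 / n * (25 * (2 * A + 1) / (m * n))"
      using q4 A mn by (intro mult_right_mono) auto
    also have "\<dots> = 200 * w + 100 * (1 / (n * (m * n)))"
      using m n1 by (simp add: w_def field_simps)
    also have "1 / (n * (m * n)) \<le> e"
      unfolding e_def using m n1 by (intro divide_left_mono mult_left_mono mult_pos_pos) auto
    finally have 2: "q * (25 * (2 * A + 1) / (m * n)) \<le> 200 * w + 100 * e" by simp
    have "q * (T - 1) \<le> 4 / n * (m * n)"
      using q q4 T n1 by (intro mult_mono) auto
    then have "208 * (q * (T - 1) - A) / (n * (m * n)) \<le> 208 * (4 / n * (m * n) - A) / (n * (m * n))"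
      using mn n1 by (intro divide_right_mono mult_left_mono) auto
    also have "\<dots> = 832 * e - 208 * w" using m n1 by (simp add: w_def e_def field_simps)
    finally have 3: "208 * (q * (T - 1) - A) / (n * (m * n)) \<le> 832 * e - 208 * w" .
    have "q / n \<le> 4 / n / n" using q4 n1 by (intro divide_right_mono) auto
    then have 4: "q / n \<le> 4 * e" by (simp add: e_def)
    have "D \<le> 944 * e" unfolding D_def using 1 2 3 4 by linarith
    also have "\<dots> \<le> 3 / (2 * n * sqrt m)"
    proof -
      have "0 \<le> sqrt m" using m by simp
      then have "944 * sqrt m * 2 \<le> 3 * n" using n by linarith
      then show ?thesis using n1 m by (simp add: e_def field_simps)
    qed
    finally show ?thesis .
  qed
  define Z where "Z = 25 * A\<^sup>2 / (m * n) + S + heavy_term m n K a b J"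
  have "q * (1 + pot m n K (T - 1) (a(g := a g + 1)) b J)
      + (1 - q) * pot m n K (T - 1) a (b(g := b g + 1)) J
    \<le> q * (1 + ((T - 1) / n + 6 * (T - 1) / (n * sqrt m) + 25 * (A + 1)\<^sup>2 / (m * n)
      + 208 * (T - 1) * (A + 1) / (n * (m * n)) + (light_pot m (x + (1 / n - 1)) + S)
      + (heavy_term m n K a b J + 1 / n)))
      + (1 - q) * pot m n K (T - 1) a (b(g := b g + 1)) J"
    unfolding eqT using q hT by (intro add_right_mono mult_left_mono add_left_mono) auto
  also have "\<dots> = (T - 1) / n + 1 / n + 6 * (T - 1) / (n * sqrt m) + 208 * T * A / (n * (m * n)) + Z
      + (q * (1 + light_pot m (x + (1 / n - 1))) + (1 - q) * light_pot m (x + 1 / n) - 1 / n)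
      + (D - 8 * y / (n * (m * n)))"
    unfolding eqF D_def Z_def
    by (simp add: power2_eq_square add_divide_distrib diff_divide_distrib ring_distribs mult_ac)
  also have "\<dots> \<le> (T - 1) / n + 1 / n + 6 * (T - 1) / (n * sqrt m) + 208 * T * A / (n * (m * n)) + Z
      + (light_pot m x + 9 / (2 * n * sqrt m) + 8 * y / (n * (m * n)))
      + (3 / (2 * n * sqrt m) - 8 * y / (n * (m * n)))"
    using main D by (intro add_mono diff_mono order_refl)
  also have "\<dots> = pot m n K T a b J"
  proof -
    have "9 / (2 * n * sqrt m) + 3 / (2 * n * sqrt m) = 6 / (n * sqrt m)"
      using n1 m by (simp add: field_simps)
    moreover have "6 * (T - 1) / (n * sqrt m) = 6 * T / (n * sqrt m) - 6 / (n * sqrt m)"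
      by (simp add: diff_divide_distrib right_diff_distrib)
    ultimately show ?thesis unfolding eq Z_def by (simp add: diff_divide_distrib)
  qed
  finally show ?thesis .
qed

text \<open>When \<open>g\<close> becomes heavy, its light term and the reserve
  \<open>5 * sqrt m + A / n\<close> are exchanged for \<open>heavy_pot\<close>. One
  \<open>sqrt m\<close> restores what \<open>light_pot\<close> subtracts, four cover
  \<open>4 * sqrt v\<close>, and \<open>A / n\<close> covers the shift of the root's argument by the
  other hits.\<close>

lemma pot_Some_le_None:
  fixes m n T :: real and a b :: "nat \<Rightarrow> real"
  assumes m: "m \<ge> 1" and n: "n \<ge> 1" and K: "finite K" "g \<in> K" and T: "T \<ge> 0"
    and ab: "\<And>i. a i \<ge> 0" "\<And>i. b i \<ge> 0"
  shows "pot m n K T a b (Some g) \<le> pot m n K T a b None"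
proof -
  define A o' where "A = sum a K" and "o' = sum a (K - {g})"
  have Ao: "A = a g + o'" "o' \<ge> 0" "o' \<le> A"
    using K ab by (auto simp: A_def o'_def sum.remove[of K g] sum_nonneg)
  define v where "v = (m * n - A - b g) / n"
  define x where "x = (a g + b g) / n - a g"
  have vm: "v \<le> m" using n m Ao ab[of g] by (simp add: v_def field_simps)
  have xo: "m - a g - v = x + o' / n"
    using n by (simp add: v_def x_def Ao field_simps)
  have "sqrt ((x + o' / n)\<^sup>2 + v) \<le> sqrt (x\<^sup>2 + m) + o' / n"
    using n m Ao vm by (intro sqrt_norm_shift) auto
  moreover have "sqrt v \<le> sqrt m" using vm by simp
  moreover have "heavy_pot n (m * n - A - b g) (m - a g) \<le> sqrt ((x + o' / n)\<^sup>2 + v) + 4 * sqrt v"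
    unfolding heavy_pot_def xo[symmetric] v_def by (rule min.cobounded2)
  moreover have "o' / n \<le> A / n" using Ao n by (intro divide_right_mono) auto
  ultimately have 1: "heavy_pot n (m * n - A - b g) (m - a g) \<le> light_pot m x + (5 * sqrt m + A / n)"
    unfolding light_pot_def by linarith
  have 2: "25 * o'\<^sup>2 / (m * n) \<le> 25 * A\<^sup>2 / (m * n)"
    using Ao m n by (intro divide_right_mono mult_left_mono power_mono) auto
  have 3: "208 * T * o' / (n * (m * n)) \<le> 208 * T * A / (n * (m * n))"
    using Ao m n T by (intro divide_right_mono mult_left_mono) auto
  show ?thesis
    using 1 2 3 K
    by (simp add: pot_def Let_def heavy_term_def sum.remove[of K g "\<lambda>i. light_pot m (_ i)"]
        A_def[symmetric] o'_def[symmetric] x_def[symmetric])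
qed

text \<open>Gives nonnegativity at the end of the game and a potential above \<open>m * n\<close>
  once \<open>A\<close> exceeds \<open>m * n / 5\<close>.\<close>

lemma pot_nonneg_terms:
  fixes m n T :: real and a b :: "nat \<Rightarrow> real"
  assumes m: "m \<ge> 1" and n: "n \<ge> 1" and T: "T \<ge> 0" and a: "\<And>i. a i \<ge> 0"
    and J: "\<And>i. J = Some i \<Longrightarrow> a i \<le> m \<and> 0 \<le> m * n - sum a K - b i"
  shows "25 * (sum a (K - set_option J))\<^sup>2 / (m * n) \<le> pot m n K T a b J"
proof -
  have "0 \<le> sum a (K - set_option J)" "0 \<le> sum a K" by (auto intro!: sum_nonneg a)
  moreover have "0 \<le> heavy_term m n K a b J"
    using J m n \<open>0 \<le> sum a K\<close> by (auto simp: heavy_term_def heavy_pot_nonneg split: option.split)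
  moreover have "0 \<le> (\<Sum>i\<in>K - set_option J. light_pot m ((a i + b i) / n - a i))"
    using m by (intro sum_nonneg light_pot_nonneg) auto
  ultimately show ?thesis using m n T by (simp add: pot_def Let_def)
qed

section \<open>Decks consistent with a history\<close>

definition consistent :: "(nat \<times> bool) list \<Rightarrow> nat list \<Rightarrow> bool" where
  "consistent h d \<longleftrightarrow> (\<forall>s < length h. snd (h ! s) \<longleftrightarrow> d ! s = fst (h ! s))"

text \<open>Given the history, the deck is uniform on this set, so conditional probabilities become
  ratios of cardinalities.\<close>

definition decks :: "nat \<Rightarrow> nat \<Rightarrow> (nat \<times> bool) list \<Rightarrow> nat list set" where
  "decks m n h = {d \<in> permutations_of_multiset (deck_mset m n). consistent h d}"

abbreviation hits :: "(nat \<times> bool) list \<Rightarrow> nat \<Rightarrow> nat" where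
  "hits h i \<equiv> count_list h (i, True)"

abbreviation misses :: "(nat \<times> bool) list \<Rightarrow> nat \<Rightarrow> nat" where
  "misses h i \<equiv> count_list h (i, False)"

abbreviation hist_on :: "nat \<Rightarrow> (nat \<times> bool) list \<Rightarrow> bool" where
  "hist_on n h \<equiv> fst ` set h \<subseteq> {1..n}"

lemma count_list_card: "count_list xs x = card {s. s < length xs \<and> xs ! s = x}"
  by (simp add: count_list_eq_length_filter length_filter_conv_card eq_commute)

lemma count_deck_mset: "count (deck_mset m n) i = (if i \<in> {1..n} then m else 0)"
  by (auto simp: deck_mset_def count_sum sum.delta)

lemma size_deck_mset: "size (deck_mset m n) = m * n"
  by (simp add: deck_mset_def)

lemma finite_decks: "finite (decks m n h)"
  by (simp add: decks_def)

lemma decksD: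
  assumes "d \<in> decks m n h"
  shows "mset d = deck_mset m n" "length d = m * n" "consistent h d"
  using assms size_deck_mset[of m n]
  by (auto simp: decks_def permutations_of_multiset_def simp flip: size_mset)

lemma consistent_snoc:
  "consistent (h @ [(g, b)]) d \<longleftrightarrow> consistent h d \<and> (b \<longleftrightarrow> d ! length h = g)"
  by (auto simp: consistent_def nth_append less_Suc_eq)

lemma decks_snoc:
  "decks m n (h @ [(g, b)]) = {d \<in> decks m n h. b \<longleftrightarrow> d ! length h = g}"
  by (auto simp: decks_def consistent_snoc)

lemma card_decks_snoc:
  "card (decks m n (h @ [(g, True)])) + card (decks m n (h @ [(g, False)])) = card (decks m n h)"
proof -
  have "decks m n h = decks m n (h @ [(g, True)]) \<union> decks m n (h @ [(g, False)])"
    by (auto simp: decks_snoc)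
  moreover have "decks m n (h @ [(g, True)]) \<inter> decks m n (h @ [(g, False)]) = {}"
    by (auto simp: decks_snoc)
  ultimately show ?thesis by (simp add: card_Un_disjoint finite_decks)
qed

lemma sum_hits_misses:
  assumes "hist_on n h"
  shows "(\<Sum>i\<in>{1..n}. hits h i + misses h i) = length h"
  using assms
proof (induction h)
  case (Cons x h)
  obtain g b where x: "x = (g, b)" by (cases x)
  have "(\<Sum>i\<in>{1..n}. hits (x # h) i + misses (x # h) i)
    = (\<Sum>i\<in>{1..n}. (if i = g then 1 else 0) + (hits h i + misses h i))"
    by (intro sum.cong) (auto simp: x)
  then show ?case using Cons by (simp add: sum.distrib x)
qed simp

text \<open>The places where an unfound copy of \<open>g\<close> may lie. Confirmed cards are left
  out even if they are \<open>g\<close>, since \<open>hits\<close> accounts for them.\<close>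

definition open_positions :: "nat \<Rightarrow> (nat \<times> bool) list \<Rightarrow> nat \<Rightarrow> nat set" where
  "open_positions N h g = {s. s < N \<and> (s < length h \<longrightarrow> \<not> snd (h ! s) \<and> h ! s \<noteq> (g, False))}"

lemma card_open_positions:
  assumes "length h \<le> N" "hist_on n h"
  shows "card (open_positions N h g) + (\<Sum>i\<in>{1..n}. hits h i) + misses h g = N"
proof -
  define P where "P x = {s. s < length h \<and> h ! s = x}" for x
  have "{..<N} = open_positions N h g \<union> ((\<Union>i\<in>{1..n}. P (i, True)) \<union> P (g, False))"
  proof
    show "{..<N} \<subseteq> open_positions N h g \<union> ((\<Union>i\<in>{1..n}. P (i, True)) \<union> P (g, False))"
    proof
      fix s assume s: "s \<in> {..<N}"
      show "s \<in> open_positions N h g \<union> ((\<Union>i\<in>{1..n}. P (i, True)) \<union> P (g, False))"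
      proof (cases "s < length h \<and> snd (h ! s)")
        case True
        then have "fst (h ! s) \<in> {1..n}" using assms(2) by (auto simp: image_subset_iff)
        then show ?thesis using True by (auto simp: P_def prod_eq_iff)
      qed (use s in \<open>auto simp: open_positions_def P_def\<close>)
    qed
  qed (use assms(1) in \<open>auto simp: open_positions_def P_def\<close>)
  from arg_cong[OF this, of card]
  have "N = card (open_positions N h g \<union> ((\<Union>i\<in>{1..n}. P (i, True)) \<union> P (g, False)))"
    by (simp only: card_lessThan)
  also have "\<dots> = card (open_positions N h g) + card ((\<Union>i\<in>{1..n}. P (i, True)) \<union> P (g, False))"
    by (intro card_Un_disjoint) (auto simp: open_positions_def P_def)
  also have "card ((\<Union>i\<in>{1..n}. P (i, True)) \<union> P (g, False))
    = card (\<Union>i\<in>{1..n}. P (i, True)) + card (P (g, False))"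
    by (intro card_Un_disjoint) (auto simp: P_def)
  also have "card (\<Union>i\<in>{1..n}. P (i, True)) = (\<Sum>i\<in>{1..n}. card (P (i, True)))"
    by (intro card_UN_disjoint) (auto simp: P_def)
  finally show ?thesis by (simp add: P_def count_list_card)
qed

section \<open>Bounding the hit probability by transpositions and double counting\<close>

definition swap_at :: "nat \<Rightarrow> nat \<Rightarrow> 'a list \<Rightarrow> 'a list" where
  "swap_at i j xs = xs[i := xs ! j, j := xs ! i]"

lemma nth_swap_at:
  "i < length xs \<Longrightarrow> j < length xs \<Longrightarrow> k < length xs \<Longrightarrow>
    swap_at i j xs ! k = (if k = i then xs ! j else if k = j then xs ! i else xs ! k)"
  by (auto simp: swap_at_def nth_list_update)

lemma swap_at_swap_at: "i < length xs \<Longrightarrow> j < length xs \<Longrightarrow> swap_at i j (swap_at i j xs) = xs"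
  by (auto intro!: nth_equalityI simp: swap_at_def nth_list_update)

text \<open>Transposing the current position with \<open>s\<close> is injective. It keeps
  consistency: the current position is unconstrained, and an already played \<open>s\<close> only
  excludes a label other than \<open>g\<close>. The inverse may fail, as it can put the label
  wrongly guessed at \<open>s\<close> back there.\<close>

lemma card_hit_le_card_at_open:
  assumes t: "length h < m * n" and s: "s \<in> open_positions (m * n) h g"
  shows "card {d \<in> decks m n h. d ! length h = g} \<le> card {d \<in> decks m n h. d ! s = g}"
proof (rule card_inj_on_le[where f = "swap_at (length h) s"])
  have sN: "s < m * n" using s by (simp add: open_positions_def)
  show "inj_on (swap_at (length h) s) {d \<in> decks m n h. d ! length h = g}"
    using t sN by (intro inj_on_inverseI[where g = "swap_at (length h) s"])
      (auto simp: swap_at_swap_at decksD(2))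
  show "swap_at (length h) s ` {d \<in> decks m n h. d ! length h = g} \<subseteq> {d \<in> decks m n h. d ! s = g}"
  proof (rule image_subsetI)
    fix d assume "d \<in> {d \<in> decks m n h. d ! length h = g}"
    then have d: "d \<in> decks m n h" "d ! length h = g" by auto
    note D = decksD[OF d(1)]
    have nth: "swap_at (length h) s d ! k =
      (if k = length h then d ! s else if k = s then g else d ! k)" if "k < m * n" for k
      using that t sN D d by (simp add: nth_swap_at)
    have "mset (swap_at (length h) s d) = deck_mset m n"
      using t sN D by (simp add: swap_at_def mset_swap)
    moreover have "consistent h (swap_at (length h) s d)"
      unfolding consistent_def
    proof (intro allI impI)
      fix k assume k: "k < length h"
      have dk: "snd (h ! k) \<longleftrightarrow> d ! k = fst (h ! k)" using D(3) k by (simp add: consistent_def)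
      show "snd (h ! k) \<longleftrightarrow> swap_at (length h) s d ! k = fst (h ! k)"
      proof (cases "k = s")
        case True
        then have "\<not> snd (h ! k)" "fst (h ! k) \<noteq> g"
          using s k by (auto simp: open_positions_def prod_eq_iff)
        then show ?thesis using True nth[of k] k t by auto
      qed (use nth[of k] k t dk in auto)
    qed
    moreover have "swap_at (length h) s d ! s = g" using nth[of s] sN d by auto
    ultimately show "swap_at (length h) s d \<in> {d \<in> decks m n h. d ! s = g}"
      by (simp add: decks_def permutations_of_multiset_def)
  qed
qed (simp add: finite_decks)

lemma open_matches:
  assumes d: "d \<in> decks m n h" and g: "g \<in> {1..n}" and t: "length h \<le> m * n"
  shows "card {s \<in> open_positions (m * n) h g. d ! s = g} + hits h g = m"
proof -
  note D = decksD[OF d]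
  have con: "s < length h \<Longrightarrow> snd (h ! s) \<longleftrightarrow> d ! s = fst (h ! s)" for s
    using D(3) by (simp add: consistent_def)
  have "m = count_list d g" using D(1) count_deck_mset[of m n g] g by (metis count_mset)
  also have "\<dots> = card {s. s < m * n \<and> d ! s = g}" by (simp add: count_list_card D(2))
  also have "{s. s < m * n \<and> d ! s = g} = {s \<in> open_positions (m * n) h g. d ! s = g}
    \<union> {s. s < length h \<and> h ! s = (g, True)}"
    using con t by (force simp: open_positions_def prod_eq_iff)
  also have "card \<dots> = card {s \<in> open_positions (m * n) h g. d ! s = g}
    + card {s. s < length h \<and> h ! s = (g, True)}"
    by (intro card_Un_disjoint) (auto simp: open_positions_def)
  finally show ?thesis by (simp add: count_list_card)
qed

lemma hits_le:
  assumes "d \<in> decks m n h" "g \<in> {1..n}" "length h \<le> m * n"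
  shows "hits h g \<le> m"
  using open_matches[OF assms] by linarith

text \<open>Sum the transposition bound over all open positions and count the pairs of a deck and an
  open position holding \<open>g\<close> by decks: each deck contributes its unfound copies of
  \<open>g\<close>.\<close>

lemma card_hit_decks_le:
  assumes g: "g \<in> {1..n}" and t: "length h < m * n" and h: "hist_on n h"
  shows "real (card (decks m n (h @ [(g, True)])))
      * (real (m * n) - (\<Sum>i\<in>{1..n}. real (hits h i)) - real (misses h g))
    \<le> (real m - real (hits h g)) * real (card (decks m n h))"
proof -
  define P where "P = open_positions (m * n) h g"
  have finP: "finite P" by (simp add: P_def open_positions_def)
  have "card P + (\<Sum>i\<in>{1..n}. hits h i) + misses h g = m * n"
    unfolding P_def using t h by (intro card_open_positions) auto
  from arg_cong[OF this, of real]
  have P: "real (card P) = real (m * n) - (\<Sum>i\<in>{1..n}. real (hits h i)) - real (misses h g)"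
    by simp
  have "card (decks m n (h @ [(g, True)])) * card P \<le> (\<Sum>s\<in>P. card {d \<in> decks m n h. d ! s = g})"
  proof -
    have "card (decks m n (h @ [(g, True)])) * card P = (\<Sum>s\<in>P. card (decks m n (h @ [(g, True)])))"
      by simp
    also have "\<dots> \<le> (\<Sum>s\<in>P. card {d \<in> decks m n h. d ! s = g})"
      using card_hit_le_card_at_open[OF t] by (intro sum_mono) (simp add: P_def decks_snoc)
    finally show ?thesis .
  qed
  also have "\<dots> = (\<Sum>s\<in>P. \<Sum>d\<in>decks m n h. if d ! s = g then 1 else 0)"
    by (intro sum.cong refl) (simp add: sum.If_cases finite_decks Int_def)
  also have "\<dots> = (\<Sum>d\<in>decks m n h. \<Sum>s\<in>P. if d ! s = g then 1 else 0)"
    by (rule sum.swap)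
  also have "\<dots> = (\<Sum>d\<in>decks m n h. card {s \<in> P. d ! s = g})"
    by (intro sum.cong refl) (simp add: sum.If_cases finP Int_def)
  finally have "real (card (decks m n (h @ [(g, True)])) * card P)
    \<le> real (\<Sum>d\<in>decks m n h. card {s \<in> P. d ! s = g})" by (rule of_nat_mono)
  also have "\<dots> = (\<Sum>d\<in>decks m n h. real m - real (hits h g))"
    unfolding of_nat_sum P_def
  proof (rule sum.cong)
    fix d assume "d \<in> decks m n h"
    from arg_cong[OF open_matches[OF this g], of real] t
    show "real (card {s \<in> open_positions (m * n) h g. d ! s = g}) = real m - real (hits h g)"
      by simp
  qed simp
  finally show ?thesis by (simp add: P mult.commute)
qed

section \<open>Expected score summed over the consistent decks\<close>

lemma finite_set_pmf_play:
  assumes "valid_strategy n G"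
  shows "finite (set_pmf (play G h cs))"
proof (induction cs arbitrary: h)
  case (Cons c cs)
  have "finite (set_pmf (G h))"
    using assms finite_subset[of "set_pmf (G h)" "{1..n}"] by (simp add: valid_strategy_def)
  then show ?case using Cons by simp
qed simp

definition play_value :: "strategy \<Rightarrow> (nat \<times> bool) list \<Rightarrow> nat list \<Rightarrow> real" where
  "play_value G h cs = measure_pmf.expectation (play G h cs) real"

lemma play_value_Nil: "play_value G h [] = 0"
  by (simp add: play_value_def)

lemma play_value_Cons:
  assumes "valid_strategy n G"
  shows "play_value G h (c # cs) = (\<Sum>g\<in>{1..n}. pmf (G h) g *
    ((if g = c then 1 else 0) + play_value G (h @ [(g, g = c)]) cs))"
proof -
  have "play_value G h (c # cs) = (\<Sum>g\<in>{1..n}. pmf (G h) g *\<^sub>R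
    measure_pmf.expectation
      (map_pmf (\<lambda>k. k + (if g = c then 1 else 0)) (play G (h @ [(g, g = c)]) cs)) real)"
    unfolding play_value_def play.simps using assms
    by (intro pmf_expectation_bind)
      (auto simp: valid_strategy_def finite_set_pmf_play[OF assms])
  also have "\<dots> = (\<Sum>g\<in>{1..n}. pmf (G h) g *
    ((if g = c then 1 else 0) + play_value G (h @ [(g, g = c)]) cs))"
    by (intro sum.cong refl)
      (auto simp: play_value_def integrable_measure_pmf_finite finite_set_pmf_play[OF assms])
  finally show ?thesis .
qed

lemma sum_pmf_strategy:
  assumes "valid_strategy n G"
  shows "(\<Sum>g\<in>{1..n}. pmf (G h) g) = 1"
  using assms by (intro sum_pmf_eq_1) (auto simp: valid_strategy_def)

text \<open>A sum instead of a conditional expectation: the values after a hit and after a miss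
  simply add, and an empty set of decks needs no convention.\<close>

definition decks_value :: "nat \<Rightarrow> nat \<Rightarrow> strategy \<Rightarrow> (nat \<times> bool) list \<Rightarrow> real" where
  "decks_value m n G h = (\<Sum>d\<in>decks m n h. play_value G h (drop (length h) d))"

lemma decks_value_full: "m * n \<le> length h \<Longrightarrow> decks_value m n G h = 0"
  by (simp add: decks_value_def decksD(2) play_value_Nil)

lemma decks_value_step:
  assumes G: "valid_strategy n G" and t: "length h < m * n"
  shows "decks_value m n G h = (\<Sum>g\<in>{1..n}. pmf (G h) g *
    (real (card (decks m n (h @ [(g, True)]))) + decks_value m n G (h @ [(g, True)])
      + decks_value m n G (h @ [(g, False)])))"
proof -
  let ?v = "\<lambda>g b d. play_value G (h @ [(g, b)]) (drop (Suc (length h)) d)"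
  have "decks_value m n G h = (\<Sum>d\<in>decks m n h. \<Sum>g\<in>{1..n}. pmf (G h) g *
    ((if d ! length h = g then 1 else 0) + ?v g (d ! length h = g) d))"
    unfolding decks_value_def
  proof (rule sum.cong)
    fix d assume "d \<in> decks m n h"
    then have "drop (length h) d = d ! length h # drop (Suc (length h)) d"
      using t by (simp add: Cons_nth_drop_Suc decksD(2))
    then show "play_value G h (drop (length h) d) = (\<Sum>g\<in>{1..n}. pmf (G h) g *
      ((if d ! length h = g then 1 else 0) + ?v g (d ! length h = g) d))"
      by (simp add: play_value_Cons[OF G] eq_commute[of _ "d ! length h"])
  qed simp
  also have "\<dots> = (\<Sum>g\<in>{1..n}. pmf (G h) g * (\<Sum>d\<in>decks m n h.
    (if d ! length h = g then 1 else 0) + ?v g (d ! length h = g) d))"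
    by (subst sum.swap) (simp add: sum_distrib_left)
  also have "\<dots> = (\<Sum>g\<in>{1..n}. pmf (G h) g *
    (real (card (decks m n (h @ [(g, True)]))) + decks_value m n G (h @ [(g, True)])
      + decks_value m n G (h @ [(g, False)])))"
  proof (intro sum.cong refl arg_cong2[where f = "(*)"])
    fix g
    have "(\<Sum>d\<in>decks m n h. (if d ! length h = g then 1 else 0) + ?v g (d ! length h = g) d)
      = (\<Sum>d\<in>decks m n h. if d ! length h = g then 1 + ?v g True d else ?v g False d)"
      by (intro sum.cong) auto
    also have "\<dots> = (\<Sum>d\<in>decks m n (h @ [(g, True)]). 1 + ?v g True d)
      + (\<Sum>d\<in>decks m n (h @ [(g, False)]). ?v g False d)"
      by (simp add: sum.If_cases finite_decks decks_snoc Int_def)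
    finally show "(\<Sum>d\<in>decks m n h. (if d ! length h = g then 1 else 0) + ?v g (d ! length h = g) d)
      = real (card (decks m n (h @ [(g, True)]))) + decks_value m n G (h @ [(g, True)])
      + decks_value m n G (h @ [(g, False)])"
      by (simp add: decks_value_def sum.distrib)
  qed
  finally show ?thesis .
qed

text \<open>A randomized guess averages over fixed guesses, so a bound for every fixed guess
  suffices and randomization disappears from here on.\<close>

lemma decks_value_le_of_step:
  assumes G: "valid_strategy n G" and t: "length h < m * n"
    and le: "\<And>g. g \<in> {1..n} \<Longrightarrow>
      real (card (decks m n (h @ [(g, True)]))) + decks_value m n G (h @ [(g, True)])
      + decks_value m n G (h @ [(g, False)]) \<le> c"
  shows "decks_value m n G h \<le> c"
proof -
  have "decks_value m n G h \<le> (\<Sum>g\<in>{1..n}. pmf (G h) g * c)"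
    unfolding decks_value_step[OF G t] by (intro sum_mono mult_left_mono le) auto
  also have "\<dots> = c" by (simp only: sum_distrib_right[symmetric] sum_pmf_strategy[OF G] mult_1)
  finally show ?thesis .
qed

lemma decks_value_le_rounds_left:
  assumes "valid_strategy n G" "length h \<le> m * n"
  shows "decks_value m n G h \<le> real (card (decks m n h)) * (real (m * n) - real (length h))"
  using assms(2)
proof (induction "m * n - length h" arbitrary: h)
  case 0
  then show ?case by (simp add: decks_value_full)
next
  case (Suc k)
  have t: "length h < m * n" using Suc(2) by (metis zero_less_Suc zero_less_diff)
  show ?case
  proof (rule decks_value_le_of_step[OF assms(1) t])
    fix g
    let ?c = "\<lambda>b. real (card (decks m n (h @ [(g, b)])))"
    let ?r = "real (m * n) - real (length h)"
    have IH: "decks_value m n G (h @ [(g, b)]) \<le> ?c b * (?r - 1)" for b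
      using Suc(1)[of "h @ [(g, b)]"] Suc(2,3) by (auto simp: algebra_simps)
    have cards: "real (card (decks m n h)) = ?c True + ?c False"
      using card_decks_snoc[of m n h g] by linarith
    have "?c True + decks_value m n G (h @ [(g, True)]) + decks_value m n G (h @ [(g, False)])
      \<le> ?c True + ?c True * (?r - 1) + ?c False * (?r - 1)"
      using IH by (intro add_mono order_refl)
    also have "\<dots> \<le> real (card (decks m n h)) * ?r"
      unfolding cards by (simp add: algebra_simps)
    finally show "?c True + decks_value m n G (h @ [(g, True)]) + decks_value m n G (h @ [(g, False)])
      \<le> real (card (decks m n h)) * ?r" .
  qed
qed

lemma expectation_score:
  assumes G: "valid_strategy n G"
  shows "measure_pmf.expectation (score m n G) real
    = decks_value m n G [] / real (card (decks m n []))"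
proof -
  have D: "permutations_of_multiset (deck_mset m n) = decks m n []"
    by (simp add: decks_def consistent_def)
  have ne: "decks m n [] \<noteq> {}" unfolding D[symmetric] by simp
  have "measure_pmf.expectation (score m n G) real
    = (\<Sum>d\<in>decks m n []. pmf (pmf_of_set (decks m n [])) d *\<^sub>R play_value G [] d)"
    unfolding score_def deck_def D play_value_def using ne
    by (intro pmf_expectation_bind) (auto simp: finite_decks finite_set_pmf_play[OF G])
  also have "\<dots> = decks_value m n G [] / real (card (decks m n []))"
    by (simp add: decks_value_def finite_decks ne sum_divide_distrib)
  finally show ?thesis .
qed

section \<open>The bound on the score\<close>

text \<open>Half is measured against all \<open>m * n\<close> rounds, not those played so far, so a
  heavy label stays heavy.\<close>

definition admissible :: "nat \<Rightarrow> nat \<Rightarrow> (nat \<times> bool) list \<Rightarrow> nat option \<Rightarrow> bool" where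
  "admissible m n h J \<longleftrightarrow>
    (\<forall>i\<in>{1..n}. Some i \<noteq> J \<longrightarrow> 2 * (hits h i + misses h i) \<le> m * n) \<and>
    (\<forall>i. J = Some i \<longrightarrow> i \<in> {1..n} \<and> m * n < 2 * (hits h i + misses h i))"

definition hist_pot :: "nat \<Rightarrow> nat \<Rightarrow> (nat \<times> bool) list \<Rightarrow> nat option \<Rightarrow> real" where
  "hist_pot m n h J = pot (real m) (real n) {1..n} (real (m * n) - real (length h))
    (\<lambda>i. real (hits h i)) (\<lambda>i. real (misses h i)) J"

lemma hist_pot_snoc:
  "hist_pot m n (h @ [(g, True)]) J = pot (real m) (real n) {1..n}
    (real (m * n) - real (length h) - 1)
    ((\<lambda>i. real (hits h i))(g := real (hits h g) + 1)) (\<lambda>i. real (misses h i)) J"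
  "hist_pot m n (h @ [(g, False)]) J = pot (real m) (real n) {1..n}
    (real (m * n) - real (length h) - 1)
    (\<lambda>i. real (hits h i)) ((\<lambda>i. real (misses h i))(g := real (misses h g) + 1)) J"
  unfolding hist_pot_def
  by (intro arg_cong3[where f = "\<lambda>T a b. pot (real m) (real n) {1..n} T a b J"]; auto)+

text \<open>Heaviness depends on the number of guesses only, so \<open>J'\<close> can be chosen
  before the outcome \<open>b\<close> is known.\<close>

lemma admissible_snoc:
  assumes J: "admissible m n h J" and g: "g \<in> {1..n}" and h: "hist_on n h"
    and t: "length h < m * n"
  obtains J' where "\<And>b. admissible m n (h @ [(g, b)]) J'" "J' = J \<or> J = None \<and> J' = Some g"
proof (cases "J = None \<and> m * n < 2 * (hits h g + misses h g + 1)")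
  case True
  then have "admissible m n (h @ [(g, b)]) (Some g)" for b
    using J g by (cases b) (auto simp: admissible_def)
  then show ?thesis using that True by blast
next
  case False
  \<comment> \<open>If \<open>i\<close> already has more than half of the rounds, \<open>g\<close>
    cannot get there as well: together they were guessed fewer than \<open>m * n\<close>
    times.\<close>
  have light: "2 * (hits h g + misses h g + 1) \<le> m * n" if gJ: "Some g \<noteq> J"
  proof (cases J)
    case (Some i)
    then have i: "i \<in> {1..n}" "i \<noteq> g" "m * n < 2 * (hits h i + misses h i)"
      using J gJ by (auto simp: admissible_def)
    have "(\<Sum>j\<in>{i, g}. hits h j + misses h j) \<le> (\<Sum>j\<in>{1..n}. hits h j + misses h j)"
      using i g by (intro sum_mono2) auto
    then show ?thesis using i t sum_hits_misses[OF h] by simp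
  qed (use False in auto)
  have "admissible m n (h @ [(g, b)]) J" for b
    unfolding admissible_def
  proof (intro conjI ballI allI impI)
    fix i assume "i \<in> {1..n}" "Some i \<noteq> J"
    then show "2 * (hits (h @ [(g, b)]) i + misses (h @ [(g, b)]) i) \<le> m * n"
      using J light by (cases "i = g"; cases b) (auto simp: admissible_def)
  next
    fix i assume "J = Some i"
    then show "i \<in> {1..n}" "m * n < 2 * (hits (h @ [(g, b)]) i + misses (h @ [(g, b)]) i)"
      using J by (auto simp: admissible_def)
  qed
  then show ?thesis using that by blast
qed

text \<open>The denominator of the hit probability is at least the number of rounds left, hence
  positive during the game.\<close>

lemma rounds_left_le:
  assumes "hist_on n h" "g \<in> {1..n}"
  shows "real (m * n) - real (length h)
    \<le> real m * real n - (\<Sum>i\<in>{1..n}. real (hits h i)) - real (misses h g)"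
proof -
  have "misses h g \<le> sum (misses h) {1..n}" using assms(2) by (intro member_le_sum) auto
  then have "sum (hits h) {1..n} + misses h g \<le> length h"
    using sum_hits_misses[OF assms(1)] by (simp add: sum.distrib)
  then have "real (sum (hits h) {1..n} + misses h g) \<le> real (length h)"
    by (rule of_nat_mono)
  then show ?thesis by simp
qed

text \<open>Induction on the rounds left. The step inequality is applied with the old
  \<open>J\<close>; a label turning heavy in this round only lowers the potential.\<close>

lemma decks_value_le_hist_pot:
  assumes G: "valid_strategy n G" and m: "m > 0" and n: "real n \<ge> 1200 * sqrt (real m)"
    and h: "hist_on n h" and t: "length h \<le> m * n" and J: "admissible m n h J"
  shows "decks_value m n G h \<le> real (card (decks m n h)) * hist_pot m n h J"
  using h t J
proof (induction "m * n - length h" arbitrary: h J rule: less_induct)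
  case (less h J)
  note h = less.prems(1) and t = less.prems(2) and J = less.prems(3)
  define T where "T = real (m * n) - real (length h)"
  define a b where "a = (\<lambda>i. real (hits h i))" and "b = (\<lambda>i. real (misses h i))"
  define A where "A = sum a ({1..n} - set_option J)"
  have m1: "real m \<ge> 1" using m by simp
  have "1 \<le> sqrt (real m)" using m1 by simp
  then have n1: "real n \<ge> 1" using n by linarith
  have T: "0 \<le> T" "T \<le> real m * real n" using t by (simp_all add: T_def flip: of_nat_mult)
  have ab: "a i \<ge> 0" "b i \<ge> 0" for i by (auto simp: a_def b_def)
  have hp: "hist_pot m n h J = pot m n {1..n} T a b J"
    by (simp add: hist_pot_def T_def a_def b_def)
  show ?case
  proof (cases "decks m n h = {}")
    case True
    then show ?thesis by (simp add: decks_value_def)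
  next
    case False
    then obtain d where d: "d \<in> decks m n h" by blast
    have am: "a i \<le> m" if "i \<in> {1..n}" for i
      using hits_le[OF d that t] by (simp add: a_def)
    have L: "T \<le> real m * real n - sum a {1..n} - b i" if "i \<in> {1..n}" for i
      using rounds_left_le[OF h that, of m] by (simp add: T_def a_def b_def)
    have Ji: "i \<in> {1..n} \<and> a i \<le> m \<and> 0 \<le> real m * real n - sum a {1..n} - b i" if "J = Some i" for i
    proof -
      have "i \<in> {1..n}" using J that by (simp add: admissible_def)
      then show ?thesis using am L T(1) by force
    qed
    have potA: "25 * A\<^sup>2 / (real m * real n) \<le> hist_pot m n h J"
      unfolding hp A_def using Ji by (intro pot_nonneg_terms m1 n1 T ab) auto
    have mn: "real m * real n > 0" using m1 n1 by (intro mult_pos_pos) auto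
    \<comment> \<open>For large \<open>A\<close> the potential exceeds the number of rounds left and
      the trivial bound suffices; only the last case needs the step inequality.\<close>
    consider "T = 0" | "A > real m * real n / 5" | "T > 0" "A \<le> real m * real n / 5"
      using T by linarith
    then show ?thesis
    proof cases
      case 1
      have "0 \<le> 25 * A\<^sup>2 / (real m * real n)" using mn by simp
      then have "0 \<le> hist_pot m n h J" using potA by linarith
      moreover have "m * n \<le> length h" using 1 by (simp add: T_def flip: of_nat_mult)
      ultimately show ?thesis by (simp add: decks_value_full)
    next
      case 2
      have "(real m * real n / 5)\<^sup>2 \<le> A\<^sup>2" using 2 mn by (intro power_mono) auto
      then have "real m * real n \<le> 25 * A\<^sup>2 / (real m * real n)"
        using mn by (simp add: field_simps power2_eq_square)
      then have "T \<le> hist_pot m n h J" using potA T by linarith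
      then have "real (card (decks m n h)) * T \<le> real (card (decks m n h)) * hist_pot m n h J"
        by (intro mult_left_mono) auto
      then show ?thesis
        using decks_value_le_rounds_left[OF G t] by (simp add: T_def)
    next
      case 3
      have t': "length h < m * n" using 3(1) by (simp add: T_def flip: of_nat_mult)
      have T1: "T \<ge> 1" using t' by (simp add: T_def flip: of_nat_mult)
      show ?thesis
      proof (rule decks_value_le_of_step[OF G t'])
        fix g assume g: "g \<in> {1..n}"
        define c where "c = real (card (decks m n h))"
        define cT cF where "cT = real (card (decks m n (h @ [(g, True)])))"
          and "cF = real (card (decks m n (h @ [(g, False)])))"
        define PT PF where "PT = hist_pot m n (h @ [(g, True)]) J"
          and "PF = hist_pot m n (h @ [(g, False)]) J"
        have c: "c > 0" using False by (simp add: c_def card_gt_0_iff finite_decks)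
        have cTF: "cT + cF = c" unfolding cT_def cF_def c_def
          using card_decks_snoc[of m n h g] by linarith
        \<comment> \<open>The conditional probability that guessing \<open>g\<close> is
          correct.\<close>
        define q where "q = cT / c"
        have q: "0 \<le> q" "q \<le> 1" using c cTF by (auto simp: q_def cT_def cF_def)
        have "cT * (real m * real n - sum a {1..n} - b g) \<le> (m - a g) * c"
          using card_hit_decks_le[OF g t' h] by (simp add: cT_def c_def a_def b_def)
        then have qL: "q * (real m * real n - sum a {1..n} - b g) \<le> m - a g"
          using c by (simp add: q_def field_simps)
        have PTF: "PT = pot m n {1..n} (T - 1) (a(g := a g + 1)) b J"
          "PF = pot m n {1..n} (T - 1) a (b(g := b g + 1)) J"
          unfolding PT_def PF_def hist_pot_snoc a_def b_def T_def by simp_all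
        have "q * (1 + PT) + (1 - q) * PF \<le> pot m n {1..n} T a b J"
        proof (cases "J = Some g")
          case True
          have "1 \<le> real m * real n - sum a {1..n} - b g" using L[OF g] T1 by linarith
          then show ?thesis unfolding PTF True
            using qL q g T1 ab m1 n1 by (intro pot_heavy_step) auto
        next
          case False
          then have "2 * (hits h g + misses h g) \<le> m * n" using J g by (auto simp: admissible_def)
          then have "real (2 * (hits h g + misses h g)) \<le> real (m * n)" by (rule of_nat_mono)
          then have "2 * (a g + b g) \<le> real m * real n" by (simp add: a_def b_def)
          then show ?thesis unfolding PTF
            using qL q g T1 T ab m1 n Ji 3(2) False unfolding A_def
            by (intro pot_light_step) auto
        qed
        then have step: "c * (q * (1 + PT) + (1 - q) * PF) \<le> c * hist_pot m n h J"
          unfolding hp using c by (intro mult_left_mono) auto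
        obtain J' where J': "\<And>b. admissible m n (h @ [(g, b)]) J'" "J' = J \<or> J = None \<and> J' = Some g"
          using admissible_snoc[OF J g h t'] by metis
        have IH: "decks_value m n G (h @ [(g, b)])
          \<le> real (card (decks m n (h @ [(g, b)]))) * hist_pot m n (h @ [(g, b)]) J" for b
        proof -
          have "decks_value m n G (h @ [(g, b)])
            \<le> real (card (decks m n (h @ [(g, b)]))) * hist_pot m n (h @ [(g, b)]) J'"
            using t' h g J'(1) by (intro less.hyps) auto
          also have "hist_pot m n (h @ [(g, b)]) J' \<le> hist_pot m n (h @ [(g, b)]) J"
          proof (cases "J' = J")
            case False
            then have "J = None" "J' = Some g" using J'(2) by auto
            moreover have "real (m * n) - real (length (h @ [(g, b)])) \<ge> 0"
              using t' by (simp flip: of_nat_mult)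
            ultimately show ?thesis unfolding hist_pot_def
              using g m1 n1 by (simp only:) (intro pot_Some_le_None; simp)
          qed simp
          finally show ?thesis by (simp add: mult_left_mono)
        qed
        have "cT + decks_value m n G (h @ [(g, True)]) + decks_value m n G (h @ [(g, False)])
          \<le> cT + cT * PT + cF * PF"
          unfolding cT_def cF_def PT_def PF_def using IH by (intro add_mono order_refl)
        also have "\<dots> = c * (q * (1 + PT) + (1 - q) * PF)"
        proof -
          have cq: "c * q = cT" "c * (1 - q) = cF"
            using c cTF by (simp_all add: q_def right_diff_distrib)
          have "c * (q * (1 + PT) + (1 - q) * PF) = (c * q) * (1 + PT) + (c * (1 - q)) * PF"
            by (simp only: distrib_left mult.assoc)
          then show ?thesis unfolding cq by (simp add: distrib_left)
        qed
        finally show "real (card (decks m n (h @ [(g, True)]))) + decks_value m n G (h @ [(g, True)])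
          + decks_value m n G (h @ [(g, False)]) \<le> real (card (decks m n h)) * hist_pot m n h J"
          using step unfolding cT_def c_def by linarith
      qed
    qed
  qed
qed

theorem theorem1p3:
  fixes m n :: nat and G :: strategy
  assumes "m > 0" and "n > 0"
    and "real n \<ge> 1200 * sqrt (real m)"
    and "valid_strategy n G"
  shows "measure_pmf.expectation (score m n G) real \<le> real m + 500 * sqrt (real m)"
proof -
  let ?c = "real (card (decks m n []))"
  have "permutations_of_multiset (deck_mset m n) = decks m n []"
    by (simp add: decks_def consistent_def)
  then have c: "?c > 0"
    by (metis card_gt_0_iff finite_decks of_nat_0_less_iff permutations_of_multiset_not_empty)
  have "decks_value m n G [] \<le> ?c * hist_pot m n [] None"
    using assms by (intro decks_value_le_hist_pot) (auto simp: admissible_def)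
  then have "measure_pmf.expectation (score m n G) real \<le> hist_pot m n [] None"
    unfolding expectation_score[OF assms(4)] using c by (simp add: divide_le_eq mult.commute)
  \<comment> \<open>At the start \<open>T = m * n\<close> and there are no hits or misses, so the
    light, linear and quadratic terms vanish.\<close>
  also have "hist_pot m n [] None = real m + 6 * (real m / sqrt (real m)) + 5 * sqrt (real m)"
    using assms by (simp add: hist_pot_def pot_def heavy_term_def light_pot_def)
  also have "real m / sqrt (real m) = sqrt (real m)" by (rule real_div_sqrt) simp
  finally have "measure_pmf.expectation (score m n G) real \<le> real m + 11 * sqrt (real m)" by simp
  also have "\<dots> \<le> real m + 500 * sqrt (real m)" by simp
  finally show ?thesis .
qed

end
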